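(* In the random-order secretary problem with $n$ items and a single uniform signal (defined in the context), the policy $\mathcal{A}(S)$ has success probability exactly $\frac1n+\frac{n-1}{2n}=\frac{n+1}{2n}>\frac12$.
   Context: Notation: $[n]=\{1,\dots,n\}$. Random-order secretary problem with a uniform signal: $n\ge 1$ items with distinct values arrive one by one at times $1,\dots,n$ in uniformly random order. Let $I\in[n]$ be the arrival time of the best item. After the arrival order has been fixed, a signal time $S$ is drawn uniformly from $[I]$, depending on the order only through $I$. At each time $t$ the policy observes the relative rank of the item arriving at time $t$ among the first $t$ items, and whether the signal occurs at time $t$ ($S=t$); it then irrevocably decides whether to stop at time $t$. A policy succeeds if it stops exactly at time $I$. A time is a record if the item arriving then is the best item so far. The policy $\mathcal{A}(S)$ rejects all items before time $S$ and accepts the first record at a time in $\{S,\dots,n\}$. *)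

theory Defs
  imports "HOL-Probability.Probability" "HOL-Combinatorics.Permutations"
begin

text \<open>
  The items are \<open>1, \<dots>, n\<close>, item \<open>i\<close> has value \<open>v i\<close> (larger is better), and an arrival order is a
  permutation \<open>\<pi>\<close> of \<open>{1..n}\<close>, where \<open>\<pi> t\<close> is the item arriving at time \<open>t\<close>.
\<close>

definition arrival_orders :: "nat \<Rightarrow> (nat \<Rightarrow> nat) set" where
  "arrival_orders n = {\<pi>. \<pi> permutes {1..n}}"

definition best_time :: "nat \<Rightarrow> (nat \<Rightarrow> real) \<Rightarrow> (nat \<Rightarrow> nat) \<Rightarrow> nat" where
  "best_time n v \<pi> = arg_max_on (\<lambda>t. v (\<pi> t)) {1..n}"

definition secretary_pmf :: "nat \<Rightarrow> (nat \<Rightarrow> real) \<Rightarrow> ((nat \<Rightarrow> nat) \<times> nat) pmf" where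
  "secretary_pmf n v =
     bind_pmf (pmf_of_set (arrival_orders n)) (\<lambda>\<pi>.
       map_pmf (\<lambda>S. (\<pi>, S)) (pmf_of_set {1..best_time n v \<pi>}))"

definition is_record :: "(nat \<Rightarrow> real) \<Rightarrow> (nat \<Rightarrow> nat) \<Rightarrow> nat \<Rightarrow> bool" where
  "is_record v \<pi> t \<longleftrightarrow> (\<forall>s\<in>{1..<t}. v (\<pi> s) < v (\<pi> t))"

text \<open>Relative rank 1 means best so far.\<close>

definition rel_rank :: "(nat \<Rightarrow> real) \<Rightarrow> (nat \<Rightarrow> nat) \<Rightarrow> nat \<Rightarrow> nat" where
  "rel_rank v \<pi> t = card {s \<in> {1..t}. v (\<pi> t) \<le> v (\<pi> s)}"

text \<open>
  An observation is a relative rank together with the information whether the signal occurs.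
  A (deterministic) policy maps the nonempty list of observations made so far, in order of time,
  to the decision whether to stop now.
\<close>

type_synonym policy = "(nat \<times> bool) list \<Rightarrow> bool"

definition history :: "(nat \<Rightarrow> real) \<Rightarrow> (nat \<Rightarrow> nat) \<Rightarrow> nat \<Rightarrow> nat \<Rightarrow> (nat \<times> bool) list" where
  "history v \<pi> S t = map (\<lambda>s. (rel_rank v \<pi> s, S = s)) [1..<Suc t]"

definition stops_at :: "policy \<Rightarrow> nat \<Rightarrow> (nat \<Rightarrow> real) \<Rightarrow> (nat \<Rightarrow> nat) \<Rightarrow> nat \<Rightarrow> nat \<Rightarrow> bool" where
  "stops_at d n v \<pi> S t \<longleftrightarrow>
     t \<in> {1..n} \<and> d (history v \<pi> S t) \<and> (\<forall>s\<in>{1..<t}. \<not> d (history v \<pi> S s))"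

definition success_prob :: "policy \<Rightarrow> nat \<Rightarrow> (nat \<Rightarrow> real) \<Rightarrow> real" where
  "success_prob d n v =
     measure_pmf.prob (secretary_pmf n v) {(\<pi>, S). stops_at d n v \<pi> S (best_time n v \<pi>)}"

text \<open>
  The policy \<open>\<A>(S)\<close>: stop as soon as the signal has occurred (now or earlier) and the current
  item is a record. Lemma \<open>stops_at_signal_policy\<close> below confirms that it accepts
  the first record at a time in \<open>{S..n}\<close>.
\<close>

definition signal_policy :: policy where
  "signal_policy h \<longleftrightarrow> (\<exists>ob\<in>set h. snd ob) \<and> fst (last h) = 1"

lemma rel_rank_eq_1_iff:
  assumes "t \<ge> 1"
  shows "rel_rank v \<pi> t = 1 \<longleftrightarrow> is_record v \<pi> t"
proof -
  let ?A = "{s \<in> {1..<t}. v (\<pi> t) \<le> v (\<pi> s)}"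
  have "{s \<in> {1..t}. v (\<pi> t) \<le> v (\<pi> s)} = insert t ?A"
    using assms by (auto simp: order.order_iff_strict)
  then have "rel_rank v \<pi> t = Suc (card ?A)"
    by (simp add: rel_rank_def)
  then show ?thesis
    by (auto simp: is_record_def not_le)
qed

lemma signal_policy_history:
  assumes "S \<ge> 1" "t \<ge> 1"
  shows "signal_policy (history v \<pi> S t) \<longleftrightarrow> S \<le> t \<and> is_record v \<pi> t"
proof -
  have "last (history v \<pi> S t) = (rel_rank v \<pi> t, S = t)"
    using assms by (simp add: history_def)
  moreover have "(\<exists>ob\<in>set (history v \<pi> S t). snd ob) \<longleftrightarrow> S \<le> t"
    using assms by (auto simp: history_def)
  ultimately show ?thesis
    using rel_rank_eq_1_iff[OF assms(2)] by (simp add: signal_policy_def)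
qed

lemma stops_at_signal_policy:
  assumes "S \<ge> 1"
  shows "stops_at signal_policy n v \<pi> S t \<longleftrightarrow>
    t \<in> {S..n} \<and> is_record v \<pi> t \<and> (\<forall>s\<in>{S..<t}. \<not> is_record v \<pi> s)"
  using assms unfolding stops_at_def by (auto simp: signal_policy_history)

lemma best_time_props:
  assumes "n \<ge> 1" "inj_on v {1..n}" "\<pi> \<in> arrival_orders n"
  shows "best_time n v \<pi> \<in> {1..n}"
    and "s \<in> {1..n} \<Longrightarrow> s \<noteq> best_time n v \<pi> \<Longrightarrow> v (\<pi> s) < v (\<pi> (best_time n v \<pi>))"
proof -
  have perm: "\<pi> permutes {1..n}"
    using assms(3) by (simp add: arrival_orders_def)
  have inj: "inj_on (\<lambda>t. v (\<pi> t)) {1..n}"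
    using comp_inj_on[of \<pi> "{1..n}" v] assms(2) permutes_inj_on[OF perm] permutes_image[OF perm]
    by (simp add: comp_def)
  have fin: "finite ((\<lambda>t. v (\<pi> t)) ` {1..n})" "(\<lambda>t. v (\<pi> t)) ` {1..n} \<noteq> {}"
    using assms(1) by auto
  then obtain m where m: "m \<in> {1..n}" "v (\<pi> m) = Max ((\<lambda>t. v (\<pi> t)) ` {1..n})"
    using Max_in[OF fin] by (metis (no_types, lifting) imageE)
  have "is_arg_max (\<lambda>t. v (\<pi> t)) (\<lambda>t. t \<in> {1..n}) m"
    using m Max_ge[OF fin(1)] by (force simp: is_arg_max_linorder)
  then have *: "is_arg_max (\<lambda>t. v (\<pi> t)) (\<lambda>t. t \<in> {1..n}) (best_time n v \<pi>)"
    unfolding best_time_def arg_max_on_def arg_max_def by (rule someI)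
  then show "best_time n v \<pi> \<in> {1..n}"
    by (simp add: is_arg_max_def)
  show "v (\<pi> s) < v (\<pi> (best_time n v \<pi>))" if "s \<in> {1..n}" "s \<noteq> best_time n v \<pi>"
    using * that inj unfolding is_arg_max_linorder inj_on_def
    by (metis order_le_less)
qed

end

theory Submission
  imports Defs
begin

text \<open>
  Let \<open>I\<close> be the best time. If \<open>I > 1\<close> and \<open>J < I\<close> is the time of the best item before \<open>I\<close>, then
  the policy succeeds exactly for the \<open>I - J\<close> signals \<open>S \<in> {J<..I}\<close>. Reversing the order of the
  arrivals before \<open>I\<close> is an involution on arrival orders that fixes \<open>I\<close> and replaces \<open>J\<close> by \<open>I - J\<close>,
  so the conditional success probabilities of an order and its image add up to \<open>1\<close>; for \<open>I = 1\<close>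
  they are both \<open>1\<close>. Hence the success probability is \<open>(1 + P(I = 1)) / 2\<close>, and \<open>P(I = 1) = 1 / n\<close>.
\<close>

text \<open>When \<open>i\<close> is the best time, these are the signals for which the policy stops
  at \<open>i\<close>. Keeping \<open>i\<close> a free parameter lets the counting below depend only
  on the arrivals before \<open>i\<close>.\<close>

definition winning_signals :: "(nat \<Rightarrow> real) \<Rightarrow> (nat \<Rightarrow> nat) \<Rightarrow> nat \<Rightarrow> nat set" where
  "winning_signals v \<pi> i = {S \<in> {1..i}. \<forall>s\<in>{S..<i}. \<not> is_record v \<pi> s}"

definition reflect :: "nat \<Rightarrow> nat \<Rightarrow> nat" where
  "reflect i t = (if t \<in> {1..<i} then i - t else t)"

lemma reflect_reflect [simp]: "reflect i (reflect i t) = t"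
  by (auto simp: reflect_def)

lemma reflect_self [simp]: "reflect i i = i"
  by (simp add: reflect_def)

lemma reflect_permutes:
  assumes "i \<le> n"
  shows "reflect i permutes {1..n}"
  unfolding permutes_def
proof (intro conjI allI impI)
  show "reflect i x = x" if "x \<notin> {1..n}" for x
    using that assms by (auto simp: reflect_def)
  show "\<exists>!x. reflect i x = y" for y
    by (metis reflect_reflect)
qed

text \<open>The maximum \<open>j\<close> of the prefix is itself a record, so a signal at or before
  \<open>j\<close> stops the policy too early; after \<open>j\<close> nothing before
  \<open>i\<close> can be a record.\<close>

lemma winning_signals_eq:
  assumes j: "j \<in> {1..<i}"
    and max: "\<And>s. s \<in> {1..<i} \<Longrightarrow> s \<noteq> j \<Longrightarrow> v (\<pi> s) < v (\<pi> j)"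
  shows "winning_signals v \<pi> i = {j<..i}"
proof -
  have "is_record v \<pi> j"
    using assms by (auto simp: is_record_def)
  moreover have "\<not> is_record v \<pi> s" if "j < s" "s < i" for s
    using max[of s] j that unfolding is_record_def
    by (metis atLeastLessThan_iff less_le_trans less_not_refl2 not_less_iff_gr_or_eq order_less_imp_le)
  ultimately show ?thesis
    using j by (force simp: winning_signals_def)
qed

text \<open>Reversing the prefix moves its maximum from \<open>j\<close> to \<open>i - j\<close>, so
  the two sets have \<open>i - j\<close> and \<open>j\<close> elements.\<close>

lemma card_winning_signals_reflect:
  assumes "1 < i" and inj: "inj_on (\<lambda>t. v (\<pi> t)) {1..<i}"
  shows "card (winning_signals v \<pi> i) + card (winning_signals v (\<pi> \<circ> reflect i) i) = i"
proof -
  have "finite {1..<i}" "{1..<i} \<noteq> {}"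
    using assms(1) by auto
  then have fin: "finite ((\<lambda>t. v (\<pi> t)) ` {1..<i})" "(\<lambda>t. v (\<pi> t)) ` {1..<i} \<noteq> {}"
    by simp_all
  obtain j where j: "j \<in> {1..<i}" "v (\<pi> j) = Max ((\<lambda>t. v (\<pi> t)) ` {1..<i})"
    using Max_in[OF fin] by force
  have less: "v (\<pi> s) < v (\<pi> j)" if "s \<in> {1..<i}" "s \<noteq> j" for s
    using Max_ge[OF fin(1) imageI[OF that(1)]] j(2) inj_onD[OF inj _ that(1) j(1)] that(2) by (auto simp: order_le_less)
  have "winning_signals v \<pi> i = {j<..i}"
    using j(1) less by (rule winning_signals_eq)
  moreover have "winning_signals v (\<pi> \<circ> reflect i) i = {i - j<..i}"
  proof (rule winning_signals_eq)
    show "v ((\<pi> \<circ> reflect i) s) < v ((\<pi> \<circ> reflect i) (i - j))"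
      if "s \<in> {1..<i}" "s \<noteq> i - j" for s
      using less[of "i - s"] that j(1) by (auto simp: reflect_def)
  qed (use j(1) in auto)
  ultimately show ?thesis
    using j(1) by simp
qed

lemma finite_arrival_orders: "finite (arrival_orders n)"
  by (simp add: arrival_orders_def finite_permutations)

lemma arrival_orders_nonempty: "arrival_orders n \<noteq> {}"
  using permutes_id[of "{1..n}"] unfolding arrival_orders_def by blast

lemma card_arrival_orders: "card (arrival_orders n) = fact n"
  by (simp add: arrival_orders_def card_permutations)

lemma arrival_orders_comp:
  "\<pi> \<in> arrival_orders n \<Longrightarrow> \<sigma> permutes {1..n} \<Longrightarrow> \<pi> \<circ> \<sigma> \<in> arrival_orders n"
  by (simp add: arrival_orders_def permutes_compose)

lemma inj_on_values:
  assumes "inj_on v {1..n}" "\<pi> \<in> arrival_orders n"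
  shows "inj_on (\<lambda>t. v (\<pi> t)) {1..n}"
proof -
  have "\<pi> permutes {1..n}"
    using assms(2) by (simp add: arrival_orders_def)
  then show ?thesis
    using comp_inj_on[of \<pi> "{1..n}" v] assms(1)
    by (simp add: comp_def permutes_inj_on permutes_image)
qed

text \<open>The best item depends only on the values, so rearranging the arrivals by
  \<open>\<sigma>\<close> merely changes when it comes.\<close>

lemma best_time_comp:
  assumes "n \<ge> 1" "inj_on v {1..n}" "\<pi> \<in> arrival_orders n" "\<sigma> permutes {1..n}"
  shows "\<sigma> (best_time n v (\<pi> \<circ> \<sigma>)) = best_time n v \<pi>"
proof (rule ccontr)
  let ?b = "best_time n v \<pi>" and ?c = "best_time n v (\<pi> \<circ> \<sigma>)"
  assume neq: "\<sigma> ?c \<noteq> ?b"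
  have comp: "\<pi> \<circ> \<sigma> \<in> arrival_orders n"
    using assms(3,4) by (rule arrival_orders_comp)
  note b = best_time_props[OF assms(1-3)] and c = best_time_props[OF assms(1,2) comp]
  \<comment> \<open>\<open>a\<close> is the time at which the rearranged order presents the best
    item of \<open>\<pi>\<close>; if it differed from \<open>?c\<close>, each of the two items would
    beat the other.\<close>
  obtain a where a: "a \<in> {1..n}" "\<sigma> a = ?b"
    using b(1) permutes_image[OF assms(4)] by (metis imageE)
  have "\<sigma> ?c \<in> {1..n}"
    using c(1) permutes_in_image[OF assms(4)] by blast
  then have "v (\<pi> (\<sigma> ?c)) < v (\<pi> ?b)"
    using neq by (rule b(2))
  moreover have "v (\<pi> (\<sigma> a)) < v (\<pi> (\<sigma> ?c))"
    using c(2)[OF a(1)] a(2) neq by auto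
  ultimately show False
    using a(2) by simp
qed

text \<open>Swapping times \<open>i\<close> and \<open>k\<close> matches the orders with best time
  \<open>i\<close> to those with best time \<open>k\<close>, so the \<open>n\<close> possible best
  times split all orders into classes of equal size.\<close>

lemma card_best_time_eq:
  assumes "n \<ge> 1" "inj_on v {1..n}" "k \<in> {1..n}"
  shows "n * card {\<pi> \<in> arrival_orders n. best_time n v \<pi> = k} = fact n"
proof -
  let ?A = "\<lambda>i. {\<pi> \<in> arrival_orders n. best_time n v \<pi> = i}"
  have "card (?A i) = card (?A k)" if i: "i \<in> {1..n}" for i
  proof -
    let ?\<tau> = "Transposition.transpose i k"
    have perm: "?\<tau> permutes {1..n}"
      using i assms(3) by (rule permutes_swap_id)
    \<comment> \<open>Stated for arbitrary \<open>a\<close>, so that it serves both directions of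
      the bijection.\<close>
    have swap: "\<pi> \<circ> ?\<tau> \<in> ?A (?\<tau> a)" if "\<pi> \<in> ?A a" for \<pi> a
      using that best_time_comp[OF assms(1,2) _ perm, of \<pi>] arrival_orders_comp[OF _ perm, of \<pi>]
      by (metis (mono_tags, lifting) mem_Collect_eq transpose_involutory)
    have "bij_betw (\<lambda>\<pi>. \<pi> \<circ> ?\<tau>) (?A i) (?A k)"
    proof (rule bij_betw_byWitness[where f' = "\<lambda>\<pi>. \<pi> \<circ> ?\<tau>"])
      show "(\<lambda>\<pi>. \<pi> \<circ> ?\<tau>) ` ?A i \<subseteq> ?A k" "(\<lambda>\<pi>. \<pi> \<circ> ?\<tau>) ` ?A k \<subseteq> ?A i"
        using swap[of _ i] swap[of _ k] by auto
    qed (simp_all add: comp_assoc)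
    then show ?thesis
      by (rule bij_betw_same_card)
  qed
  then have "n * card (?A k) = (\<Sum>i\<in>{1..n}. card (?A i))"
    by simp
  also have "\<dots> = card (\<Union>i\<in>{1..n}. ?A i)"
    by (rule card_UN_disjoint[symmetric]) (auto simp: finite_arrival_orders)
  also have "(\<Union>i\<in>{1..n}. ?A i) = arrival_orders n"
    using best_time_props(1)[OF assms(1,2)] by auto
  finally show ?thesis
    by (simp add: card_arrival_orders)
qed

text \<open>The best item is always a record, so only an earlier record at or after \<open>S\<close>
  can spoil success.\<close>

lemma stops_at_best_time_iff:
  assumes "n \<ge> 1" "inj_on v {1..n}" "\<pi> \<in> arrival_orders n" "S \<in> {1..best_time n v \<pi>}"
  shows "stops_at signal_policy n v \<pi> S (best_time n v \<pi>)
    \<longleftrightarrow> S \<in> winning_signals v \<pi> (best_time n v \<pi>)"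
proof -
  note b = best_time_props[OF assms(1-3)]
  have "is_record v \<pi> (best_time n v \<pi>)"
    using b by (auto simp: is_record_def)
  then show ?thesis
    using b(1) assms(4) by (auto simp: stops_at_signal_policy winning_signals_def)
qed

lemma success_prob_signal_policy:
  assumes "n \<ge> 1" "inj_on v {1..n}"
  shows "success_prob signal_policy n v = (\<Sum>\<pi>\<in>arrival_orders n.
    real (card (winning_signals v \<pi> (best_time n v \<pi>))) / real (best_time n v \<pi>)) / fact n"
proof -
  let ?E = "{(\<pi>, S). stops_at signal_policy n v \<pi> S (best_time n v \<pi>)}"
  have cond: "measure_pmf.prob (map_pmf (\<lambda>S. (\<pi>, S)) (pmf_of_set {1..best_time n v \<pi>})) ?E =
      real (card (winning_signals v \<pi> (best_time n v \<pi>))) / real (best_time n v \<pi>)"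
    if \<pi>: "\<pi> \<in> arrival_orders n" for \<pi>
  proof -
    have ne: "{1..best_time n v \<pi>} \<noteq> {}"
      using best_time_props(1)[OF assms \<pi>] by auto
    have "{1..best_time n v \<pi>} \<inter> (\<lambda>S. (\<pi>, S)) -` ?E = winning_signals v \<pi> (best_time n v \<pi>)"
      using stops_at_best_time_iff[OF assms \<pi>] by (auto simp: winning_signals_def)
    then show ?thesis
      using ne by (simp add: measure_pmf_of_set)
  qed
  \<comment> \<open>Total probability: condition on the arrival order, then average over the uniform
    choice of it.\<close>
  have "success_prob signal_policy n v = measure_pmf.expectation (pmf_of_set (arrival_orders n))
      (\<lambda>\<pi>. measure_pmf.prob (map_pmf (\<lambda>S. (\<pi>, S)) (pmf_of_set {1..best_time n v \<pi>})) ?E)"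
    unfolding success_prob_def secretary_pmf_def measure_pmf_bind
    by (subst measure_pmf.measure_bind[where N = "count_space UNIV"])
      (auto simp: measure_pmf_in_subprob_algebra)
  then show ?thesis
    \<comment> \<open>The deleted simp rules would rewrite the left-hand side of \<open>cond\<close>
      before it could match.\<close>
    by (simp add: integral_pmf_of_set finite_arrival_orders arrival_orders_nonempty
        card_arrival_orders cond del: measure_map_pmf One_nat_def)
qed

lemma sum_winning_fractions:
  assumes "n \<ge> 1" "inj_on v {1..n}"
  shows "2 * (\<Sum>\<pi>\<in>arrival_orders n.
      real (card (winning_signals v \<pi> (best_time n v \<pi>))) / real (best_time n v \<pi>))
    = fact n + real (card {\<pi> \<in> arrival_orders n. best_time n v \<pi> = 1})"
proof -
  let ?A = "arrival_orders n" and ?I = "best_time n v"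
  let ?f = "\<lambda>\<pi>. real (card (winning_signals v \<pi> (?I \<pi>))) / real (?I \<pi>)"
  define \<phi> where "\<phi> \<pi> = \<pi> \<circ> reflect (?I \<pi>)" for \<pi>
  have perm: "reflect (?I \<pi>) permutes {1..n}" if "\<pi> \<in> ?A" for \<pi>
    using best_time_props(1)[OF assms that] by (intro reflect_permutes) simp
  have \<phi>_in: "\<phi> \<pi> \<in> ?A" if "\<pi> \<in> ?A" for \<pi>
    using that perm[OF that] by (simp add: \<phi>_def arrival_orders_comp)
  \<comment> \<open>The reversal depends on \<open>\<pi>\<close> through its best time; since that
    time is preserved, applying \<open>\<phi>\<close> twice reverses the same prefix twice.\<close>
  have I_\<phi>: "?I (\<phi> \<pi>) = ?I \<pi>" if "\<pi> \<in> ?A" for \<pi>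
    using best_time_comp[OF assms that perm[OF that]] unfolding \<phi>_def
    by (metis reflect_reflect reflect_self)
  have \<phi>_\<phi>: "\<phi> (\<phi> \<pi>) = \<pi>" if "\<pi> \<in> ?A" for \<pi>
    using I_\<phi>[OF that] by (simp add: \<phi>_def fun_eq_iff)
  have pair: "?f \<pi> + ?f (\<phi> \<pi>) = 1 + (if ?I \<pi> = 1 then 1 else 0)" if \<pi>: "\<pi> \<in> ?A" for \<pi>
  proof (cases "?I \<pi> = 1")
    \<comment> \<open>With best time 1 the only possible signal wins, so both fractions are 1 and
      the pair exceeds the generic total 1 by 1.\<close>
    case True
    have "winning_signals v \<sigma> 1 = {1}" for \<sigma>
      by (auto simp: winning_signals_def)
    then show ?thesis
      using True I_\<phi>[OF \<pi>] by simp
  next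
    case False
    with best_time_props(1)[OF assms \<pi>] have I: "1 < ?I \<pi>" "?I \<pi> \<le> n"
      by auto
    have "inj_on (\<lambda>t. v (\<pi> t)) {1..<?I \<pi>}"
      by (rule inj_on_subset[OF inj_on_values[OF assms(2) \<pi>]]) (use I(2) in auto)
    then have "card (winning_signals v \<pi> (?I \<pi>)) + card (winning_signals v (\<phi> \<pi>) (?I \<pi>)) = ?I \<pi>"
      unfolding \<phi>_def by (rule card_winning_signals_reflect[OF I(1)])
    then have "real (card (winning_signals v \<pi> (?I \<pi>))) +
        real (card (winning_signals v (\<phi> \<pi>) (?I \<pi>))) = real (?I \<pi>)"
      by linarith
    then show ?thesis
      using I False I_\<phi>[OF \<pi>] by (simp add: add_divide_distrib[symmetric])
  qed
  \<comment> \<open>Reindexing by the involution \<open>\<phi>\<close> lets each order be paired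
    with its image.\<close>
  have "(\<Sum>\<pi>\<in>?A. ?f (\<phi> \<pi>)) = (\<Sum>\<pi>\<in>?A. ?f \<pi>)"
    by (rule sum.reindex_bij_witness[of _ \<phi> \<phi>]) (auto simp: \<phi>_in \<phi>_\<phi>)
  then have "2 * (\<Sum>\<pi>\<in>?A. ?f \<pi>) = (\<Sum>\<pi>\<in>?A. ?f \<pi> + ?f (\<phi> \<pi>))"
    by (simp add: sum.distrib)
  also have "\<dots> = (\<Sum>\<pi>\<in>?A. 1 + (if ?I \<pi> = 1 then 1 else 0))"
    by (rule sum.cong[OF refl pair])
  also have "\<dots> = real (card ?A) + real (card {\<pi> \<in> ?A. ?I \<pi> = 1})"
    by (simp add: sum.distrib sum.If_cases finite_arrival_orders Int_def)
  finally show ?thesis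
    by (simp add: card_arrival_orders)
qed

theorem mainTheorem10:
  fixes n :: nat and v :: "nat \<Rightarrow> real"
  assumes "n \<ge> 1" and "inj_on v {1..n}"
  shows "success_prob signal_policy n v = 1 / real n + (real n - 1) / (2 * real n)
    \<and> 1 / real n + (real n - 1) / (2 * real n) = (real n + 1) / (2 * real n)
    \<and> (real n + 1) / (2 * real n) > 1 / 2"
proof -
  let ?c = "real (card {\<pi> \<in> arrival_orders n. best_time n v \<pi> = 1})"
  \<comment> \<open>The best item comes first with probability \<open>1 / n\<close>.\<close>
  have "real n * ?c = fact n"
    using card_best_time_eq[OF assms, of 1] assms(1)
    by (metis atLeastAtMost_iff of_nat_fact of_nat_mult order_refl)
  then have c: "?c = fact n / real n"
    using assms(1) by (simp add: field_simps)
  have "success_prob signal_policy n v = (fact n + ?c) / 2 / fact n"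
    unfolding success_prob_signal_policy[OF assms] sum_winning_fractions[OF assms, symmetric] by simp
  also have "\<dots> = (real n + 1) / (2 * real n)"
    using assms(1) unfolding c by (simp add: field_simps)
  finally have "success_prob signal_policy n v = (real n + 1) / (2 * real n)" .
  then show ?thesis
    using assms(1) by (simp add: field_simps)
qed

end
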